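(* Let $G$ be a compactly generated topological group. Assume that $G$ admits a locally finite rough Cayley graph. Then all locally finite rough Cayley graphs for $G$ are quasi-isometric to each other.
   Context: Graphs are undirected, without loops and multiple edges; a graph is locally finite if every vertex has finitely many neighbours. A topological group is compactly generated if it has a compact generating set. Topological groups are not assumed Hausdorff and "compact" does not include the Hausdorff condition. A connected graph $\Gamma$ is a rough Cayley graph of a topological group $G$ if $G$ acts (by graph automorphisms) transitively on the vertices of $\Gamma$ and the stabilizers of vertices are compact, open subgroups of $G$. Two metric spaces $(X,d_X)$ and $(Y,d_Y)$ are quasi-isometric if there are a map $\varphi:X\rightarrow Y$ and constants $a\geq 1$, $b\geq 0$ such that for all $x_1,x_2\in X$, $a^{-1}d_X(x_1,x_2)-a^{-1}b\leq d_Y(\varphi(x_1),\varphi(x_2))\leq a\,d_X(x_1,x_2)+ab$, and $d_Y(y,\varphi(X))\leq b$ for all $y\in Y$. Two connected graphs are quasi-isometric if their vertex sets with the graph metrics are quasi-isometric. *)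

theory Defs
  imports
    "HOL-Analysis.Analysis"
    "HOL-Algebra.Group_Action"
    "HOL-Algebra.Generated_Groups"
    "Graph_Theory.Pair_Digraph"
    "Graph_Theory.Digraph_Component"
begin

section \<open>Topological groups\<close>

text \<open>No separation axiom is imposed on the topology; \<^const>\<open>compactin\<close> is the plain open cover
  property.\<close>

locale topological_group = group G
  for G (structure) and T +
  assumes topspace_eq_carrier: "topspace T = carrier G"
    and continuous_mult: "continuous_map (prod_topology T T) T (\<lambda>(x, y). x \<otimes> y)"
    and continuous_inv: "continuous_map T T (\<lambda>x. inv x)"

definition compactly_generated :: "('a, 'b) monoid_scheme \<Rightarrow> 'a topology \<Rightarrow> bool" where
  "compactly_generated G T \<longleftrightarrow> (\<exists>S. compactin T S \<and> generate G S = carrier G)"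


section \<open>Graphs\<close>

text \<open>An undirected graph without loops and multiple edges, possibly infinite, is a loop-free pair
  digraph with a symmetric arc set: the locale \<^locale>\<open>pair_bidirected_digraph\<close>.
  For such graphs \<^term>\<open>Digraph_Component.connected\<close> includes that there is at least one vertex.\<close>

definition locally_finite :: "'v pair_pre_digraph \<Rightarrow> bool" where
  "locally_finite \<Gamma> \<longleftrightarrow> (\<forall>v \<in> pverts \<Gamma>. finite {w. (v, w) \<in> parcs \<Gamma>})"

definition graph_automorphism :: "'v pair_pre_digraph \<Rightarrow> ('v \<Rightarrow> 'v) \<Rightarrow> bool" where
  "graph_automorphism \<Gamma> f \<longleftrightarrow>
     bij_betw f (pverts \<Gamma>) (pverts \<Gamma>) \<and>
     (\<forall>u \<in> pverts \<Gamma>. \<forall>v \<in> pverts \<Gamma>. (f u, f v) \<in> parcs \<Gamma> \<longleftrightarrow> (u, v) \<in> parcs \<Gamma>)"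

text \<open>The length of a shortest walk; only meaningful for vertices joined by a walk.\<close>

definition graph_dist :: "'v pair_pre_digraph \<Rightarrow> 'v \<Rightarrow> 'v \<Rightarrow> nat" where
  "graph_dist \<Gamma> u v = (LEAST n. \<exists>p. pre_digraph.awalk (with_proj \<Gamma>) u p v \<and> length p = n)"

text \<open>The type of metric spaces is a subtype, so this definition is meaningful only where
  \<^term>\<open>graph_dist\<close> is a metric; for connected graphs that is the lemma
  \<open>Metric_space_graph_dist\<close> below.\<close>

definition graph_metric :: "'v pair_pre_digraph \<Rightarrow> 'v metric" where
  "graph_metric \<Gamma> = metric (pverts \<Gamma>, \<lambda>u v. real (graph_dist \<Gamma> u v))"

lemma awalk_length_iff_relpow:
  assumes "pair_bidirected_digraph \<Gamma>"
  shows "(\<exists>p. pre_digraph.awalk (with_proj \<Gamma>) u p v \<and> length p = n)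
    \<longleftrightarrow> u \<in> pverts \<Gamma> \<and> (u, v) \<in> parcs \<Gamma> ^^ n"
proof -
  interpret pair_bidirected_digraph \<Gamma> by fact
  show ?thesis
  proof (induction n arbitrary: u)
    case 0
    then show ?case by (simp add: awalk_def)
  next
    case (Suc n)
    have step: "awalk u (e # p) v \<longleftrightarrow> e \<in> parcs \<Gamma> \<and> fst e = u \<and> awalk (snd e) p v" for e p
      unfolding awalk_def using arc_fst_in_verts arc_snd_in_verts by (simp, blast)
    have "(\<exists>p. awalk u p v \<and> length p = Suc n)
        \<longleftrightarrow> (\<exists>e p. awalk u (e # p) v \<and> length p = n)"
      unfolding length_Suc_conv by blast
    also have "\<dots> \<longleftrightarrow> (\<exists>w. (u, w) \<in> parcs \<Gamma> \<and> (\<exists>p. awalk w p v \<and> length p = n))"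
      unfolding step by simp
    also have "\<dots> \<longleftrightarrow> (\<exists>w. (u, w) \<in> parcs \<Gamma> \<and> w \<in> pverts \<Gamma> \<and> (w, v) \<in> parcs \<Gamma> ^^ n)"
      unfolding Suc.IH ..
    also have "\<dots> \<longleftrightarrow> u \<in> pverts \<Gamma> \<and> (u, v) \<in> parcs \<Gamma> ^^ Suc n"
      using in_arcsD1 in_arcsD2 by (meson relpow_Suc_I2 relpow_Suc_D2)
    finally show ?case .
  qed
qed

lemma connected_imp_walk:
  assumes "pair_bidirected_digraph \<Gamma>" "Digraph_Component.connected (with_proj \<Gamma>)"
    and "u \<in> pverts \<Gamma>" "v \<in> pverts \<Gamma>"
  shows "\<exists>n. (u, v) \<in> parcs \<Gamma> ^^ n"
proof -
  interpret pair_bidirected_digraph \<Gamma> by fact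
  have "strongly_connected (with_proj \<Gamma>)"
    using assms(2) pair_sym_arcs by (simp add: symmetric_connected_imp_strongly_connected)
  then show ?thesis
    using assms(3,4) reachable_conv
    by (auto simp: strongly_connected_def rtrancl_power)
qed

lemma Metric_space_graph_dist:
  assumes "pair_bidirected_digraph \<Gamma>" "Digraph_Component.connected (with_proj \<Gamma>)"
  shows "Metric_space (pverts \<Gamma>) (\<lambda>u v. real (graph_dist \<Gamma> u v))"
proof -
  interpret pair_bidirected_digraph \<Gamma> by fact
  let ?V = "pverts \<Gamma>" and ?E = "parcs \<Gamma>"
  have dist: "graph_dist \<Gamma> u v = (LEAST n. u \<in> ?V \<and> (u, v) \<in> ?E ^^ n)" for u v
    unfolding graph_dist_def awalk_length_iff_relpow[OF assms(1)] ..
  have "sym ?E"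
    using pair_sym_arcs by (simp add: symmetric_def)
  have flip1: "v \<in> ?V \<and> (v, u) \<in> ?E ^^ n" if "u \<in> ?V" "(u, v) \<in> ?E ^^ n" for u v n
    using that
  proof (induction n arbitrary: v)
    case (Suc n)
    then obtain w where "(u, w) \<in> ?E ^^ n" "(w, v) \<in> ?E" by auto
    with Suc \<open>sym ?E\<close> show ?case
      by (meson symD relpow_Suc_I2 in_arcsD2)
  qed simp
  then have flip: "u \<in> ?V \<and> (u, v) \<in> ?E ^^ n \<longleftrightarrow> v \<in> ?V \<and> (v, u) \<in> ?E ^^ n" for u v n
    by blast
  have walk: "(u, v) \<in> ?E ^^ graph_dist \<Gamma> u v" if "u \<in> ?V" "v \<in> ?V" for u v
    using connected_imp_walk[OF assms that] LeastI_ex[of "\<lambda>n. u \<in> ?V \<and> (u, v) \<in> ?E ^^ n"] that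
    by (auto simp: dist)
  have least: "graph_dist \<Gamma> u v \<le> n" if "u \<in> ?V" "(u, v) \<in> ?E ^^ n" for u v n
    unfolding dist using that by (intro Least_le) simp
  show ?thesis
  proof
    fix x y z
    show "real (graph_dist \<Gamma> x y) = real (graph_dist \<Gamma> y x)"
      by (simp add: dist flip[of x])
    assume x: "x \<in> ?V" and y: "y \<in> ?V"
    show "real (graph_dist \<Gamma> x y) = 0 \<longleftrightarrow> x = y"
      using walk[OF x y] least[OF x, of y 0] by auto
    assume z: "z \<in> ?V"
    have "(x, z) \<in> ?E ^^ (graph_dist \<Gamma> x y + graph_dist \<Gamma> y z)"
      using walk[OF x y] walk[OF y z] by (auto simp: relpow_add)
    from least[OF x this]
    show "real (graph_dist \<Gamma> x z) \<le> real (graph_dist \<Gamma> x y) + real (graph_dist \<Gamma> y z)"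
      by simp
  qed simp
qed


section \<open>Quasi-isometry\<close>

text \<open>The distance of a point to a set is taken as an infimum in the extended reals, so that it
  is infinite for the empty set.\<close>

definition quasi_isometric :: "'x metric \<Rightarrow> 'y metric \<Rightarrow> bool" where
  "quasi_isometric X Y \<longleftrightarrow>
     (\<exists>\<phi> a b. \<phi> ` mspace X \<subseteq> mspace Y \<and> a \<ge> 1 \<and> b \<ge> 0 \<and>
       (\<forall>x1 \<in> mspace X. \<forall>x2 \<in> mspace X.
          inverse a * mdist X x1 x2 - inverse a * b \<le> mdist Y (\<phi> x1) (\<phi> x2) \<and>
          mdist Y (\<phi> x1) (\<phi> x2) \<le> a * mdist X x1 x2 + a * b) \<and>
       (\<forall>y \<in> mspace Y. (INF z \<in> \<phi> ` mspace X. ereal (mdist Y y z)) \<le> ereal b))"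

definition quasi_isometric_graphs :: "'v pair_pre_digraph \<Rightarrow> 'w pair_pre_digraph \<Rightarrow> bool" where
  "quasi_isometric_graphs \<Gamma> \<Delta> \<longleftrightarrow> quasi_isometric (graph_metric \<Gamma>) (graph_metric \<Delta>)"


section \<open>Rough Cayley graphs\<close>

definition rough_cayley_graph ::
  "('a, 'b) monoid_scheme \<Rightarrow> 'a topology \<Rightarrow> 'v pair_pre_digraph \<Rightarrow> bool" where
  "rough_cayley_graph G T \<Gamma> \<longleftrightarrow>
     pair_bidirected_digraph \<Gamma> \<and> Digraph_Component.connected (with_proj \<Gamma>) \<and>
     (\<exists>\<phi>. transitive_action G (pverts \<Gamma>) \<phi> \<and>
        (\<forall>g \<in> carrier G. graph_automorphism \<Gamma> (\<phi> g)) \<and>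
        (\<forall>v \<in> pverts \<Gamma>.
           compactin T (stabilizer G \<phi> v) \<and> openin T (stabilizer G \<phi> v)))"

end

theory Submission
  imports Defs
begin

text \<open>Fix base vertices \<open>v\<^sub>0\<close> of \<open>\<Gamma>\<close> and \<open>w\<^sub>0\<close> of \<open>\<Delta>\<close>. Since \<open>G\<close> is transitive on both graphs,
  every vertex is \<open>g v\<^sub>0\<close>, respectively \<open>g w\<^sub>0\<close>, for some \<open>g\<close>, and the quasi-isometry sends
  \<open>g v\<^sub>0\<close> to \<open>g w\<^sub>0\<close> for some choice of \<open>g\<close>. Different choices give images at bounded distance.
  This, and everything else, follows from the estimate
  \<open>d\<^sub>\<Delta> (g w\<^sub>0, h w\<^sub>0) \<le> C d\<^sub>\<Gamma> (g v\<^sub>0, h v\<^sub>0) + C\<close> for all \<open>g, h \<in> G\<close>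
  (lemma \<open>orbit_dist_coarse_lipschitz\<close>) and the same estimate with the two graphs exchanged.

  The estimate holds for this reason. By local finiteness of \<open>\<Gamma>\<close> and compactness of the stabilizer
  of \<open>v\<^sub>0\<close>, the set of elements that move \<open>v\<^sub>0\<close> by at most one step is a finite union of cosets of
  that stabilizer, hence compact. The orbit map \<open>g \<mapsto> g w\<^sub>0\<close> is continuous into the discrete vertex
  set of \<open>\<Delta>\<close>, because the stabilizer of \<open>w\<^sub>0\<close> is open; so it takes only finitely many values on
  that compact set, and these lie within some distance \<open>C\<close> of \<open>w\<^sub>0\<close>. As \<open>G\<close> acts by isometries on
  \<open>\<Delta>\<close>, each edge of a walk from \<open>g v\<^sub>0\<close> to \<open>h v\<^sub>0\<close> in \<open>\<Gamma>\<close> costs at most \<open>C\<close> in \<open>\<Delta>\<close>.\<close>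

section \<open>Orbit maps of topological groups\<close>

lemma (in topological_group) continuous_map_left_mult:
  assumes "g \<in> carrier G"
  shows "continuous_map T T (\<lambda>x. g \<otimes> x)"
proof -
  have "continuous_map T (prod_topology T T) (\<lambda>x. (g, x))"
    using assms by (simp add: continuous_map_pairedI topspace_eq_carrier)
  from continuous_map_compose[OF this continuous_mult]
  show ?thesis by (simp add: o_def)
qed

lemma (in group_action) orbit_map_fibre_eq_translate:
  assumes "x \<in> E" and "g \<in> carrier G"
  shows "{h \<in> carrier G. \<phi> h x = \<phi> g x} = {h \<in> carrier G. inv g \<otimes> h \<in> stabilizer G \<phi> x}"
    and "{h \<in> carrier G. \<phi> h x = \<phi> g x} = (\<lambda>k. g \<otimes> k) ` stabilizer G \<phi> x"
proof -
  interpret group G using group_hom group_hom.axioms(1) by blast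
  have iff: "\<phi> h x = \<phi> g x \<longleftrightarrow> inv g \<otimes> h \<in> stabilizer G \<phi> x" if h: "h \<in> carrier G" for h
  proof
    assume "\<phi> h x = \<phi> g x"
    then have "\<phi> (inv g) (\<phi> h x) = x"
      using orbit_sym_aux[OF assms(2,1) refl] by simp
    then show "inv g \<otimes> h \<in> stabilizer G \<phi> x"
      using assms h by (simp add: stabilizer_def composition_rule)
  next
    assume "inv g \<otimes> h \<in> stabilizer G \<phi> x"
    then have "\<phi> g (\<phi> (inv g \<otimes> h) x) = \<phi> g x"
      by (simp add: stabilizer_def)
    then have "\<phi> (g \<otimes> (inv g \<otimes> h)) x = \<phi> g x"
      using assms h by (simp add: composition_rule)
    then show "\<phi> h x = \<phi> g x"
      using assms h by (simp flip: m_assoc)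
  qed
  then show 1: "{h \<in> carrier G. \<phi> h x = \<phi> g x}
      = {h \<in> carrier G. inv g \<otimes> h \<in> stabilizer G \<phi> x}"
    by blast
  show "{h \<in> carrier G. \<phi> h x = \<phi> g x} = (\<lambda>k. g \<otimes> k) ` stabilizer G \<phi> x"
  proof (intro equalityI subsetI)
    fix h assume "h \<in> {h \<in> carrier G. \<phi> h x = \<phi> g x}"
    then have "h \<in> carrier G" "inv g \<otimes> h \<in> stabilizer G \<phi> x" using iff by auto
    moreover from this have "h = g \<otimes> (inv g \<otimes> h)"
      using assms by (simp flip: m_assoc)
    ultimately show "h \<in> (\<lambda>k. g \<otimes> k) ` stabilizer G \<phi> x" by blast
  next
    fix h assume "h \<in> (\<lambda>k. g \<otimes> k) ` stabilizer G \<phi> x"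
    then show "h \<in> {h \<in> carrier G. \<phi> h x = \<phi> g x}"
      using assms by (auto simp: stabilizer_def composition_rule)
  qed
qed

text \<open>The fibres of the orbit map are the left cosets of the stabilizer, so it suffices that the
  stabilizer is open.\<close>

lemma continuous_map_orbit_map:
  fixes G (structure)
  assumes "topological_group G T" "group_action G E \<phi>" "x \<in> E"
    and "openin T (stabilizer G \<phi> x)"
  shows "continuous_map T (discrete_topology E) (\<lambda>g. \<phi> g x)"
proof -
  interpret topological_group G T by fact
  interpret group_action G E \<phi> by fact
  have fibre: "openin T {h \<in> carrier G. \<phi> h x = \<phi> g x}" if g: "g \<in> carrier G" for g
    unfolding orbit_map_fibre_eq_translate(1)[OF assms(3) g]
    using openin_continuous_map_preimage[OF continuous_map_left_mult assms(4), of "inv g"] g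
    by (simp add: topspace_eq_carrier)
  have "openin T {h \<in> carrier G. \<phi> h x \<in> U}" for U
  proof -
    have "{h \<in> carrier G. \<phi> h x \<in> U}
        = (\<Union>g \<in> {g \<in> carrier G. \<phi> g x \<in> U}. {h \<in> carrier G. \<phi> h x = \<phi> g x})"
      by auto
    also have "openin T \<dots>" using fibre by blast
    finally show ?thesis .
  qed
  then show ?thesis
    using element_image[OF _ assms(3)] by (auto simp: continuous_map_def topspace_eq_carrier)
qed

lemma compactin_orbit_map_fibre:
  fixes G (structure)
  assumes "topological_group G T" "group_action G E \<phi>" "x \<in> E"
    and "compactin T (stabilizer G \<phi> x)"
  shows "compactin T {h \<in> carrier G. \<phi> h x = y}"
proof (cases "\<exists>g \<in> carrier G. \<phi> g x = y")
  case True
  then obtain g where g: "g \<in> carrier G" "y = \<phi> g x" by blast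
  interpret topological_group G T by fact
  interpret group_action G E \<phi> by fact
  show ?thesis
    unfolding g(2) orbit_map_fibre_eq_translate(2)[OF assms(3) g(1)]
    using image_compactin[OF assms(4) continuous_map_left_mult[OF g(1)]] .
next
  case False
  then have "{h \<in> carrier G. \<phi> h x = y} = {}" by blast
  then show ?thesis by (metis compactin_empty)
qed


section \<open>Distances in connected graphs\<close>

lemma
  assumes "pair_bidirected_digraph \<Gamma>" "Digraph_Component.connected (with_proj \<Gamma>)"
    and "u \<in> pverts \<Gamma>"
  shows graph_dist_walk: "v \<in> pverts \<Gamma> \<Longrightarrow> (u, v) \<in> parcs \<Gamma> ^^ graph_dist \<Gamma> u v"
    and graph_dist_le: "(u, v) \<in> parcs \<Gamma> ^^ n \<Longrightarrow> graph_dist \<Gamma> u v \<le> n"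
proof -
  have dist: "graph_dist \<Gamma> u v = (LEAST n. (u, v) \<in> parcs \<Gamma> ^^ n)" for v
    unfolding graph_dist_def awalk_length_iff_relpow[OF assms(1)] using assms(3) by simp
  show "(u, v) \<in> parcs \<Gamma> ^^ graph_dist \<Gamma> u v" if "v \<in> pverts \<Gamma>"
    unfolding dist using connected_imp_walk[OF assms that] by (rule LeastI_ex)
  show "graph_dist \<Gamma> u v \<le> n" if "(u, v) \<in> parcs \<Gamma> ^^ n"
    unfolding dist using that by (rule Least_le)
qed

lemma graph_dist_automorphism_le:
  assumes "pair_bidirected_digraph \<Gamma>" "Digraph_Component.connected (with_proj \<Gamma>)"
    and f: "graph_automorphism \<Gamma> f" and u: "u \<in> pverts \<Gamma>" and v: "v \<in> pverts \<Gamma>"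
  shows "graph_dist \<Gamma> (f u) (f v) \<le> graph_dist \<Gamma> u v"
proof -
  interpret pair_bidirected_digraph \<Gamma> by fact
  have fV: "f w \<in> pverts \<Gamma>" if "w \<in> pverts \<Gamma>" for w
    using f that by (auto simp: graph_automorphism_def bij_betw_def)
  have "(f u, f v) \<in> parcs \<Gamma> ^^ n" if "(u, v) \<in> parcs \<Gamma> ^^ n" for n
    using that
  proof (induction n arbitrary: v)
    case (Suc n)
    then obtain w where w: "(u, w) \<in> parcs \<Gamma> ^^ n" "(w, v) \<in> parcs \<Gamma>" by auto
    then have "w \<in> pverts \<Gamma>" "v \<in> pverts \<Gamma>" using in_arcsD1 in_arcsD2 by auto
    then have "(f w, f v) \<in> parcs \<Gamma>" using f w(2) by (simp add: graph_automorphism_def)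
    with Suc.IH[OF w(1)] show ?case by auto
  qed simp
  then show ?thesis
    using graph_dist_le[OF assms(1,2) fV[OF u]] graph_dist_walk[OF assms(1,2) u v] by blast
qed


section \<open>Comparing two actions\<close>

text \<open>Transitivity on \<open>\<Gamma>\<close> makes every intermediate vertex of a walk from \<open>g v\<^sub>0\<close> to \<open>h v\<^sub>0\<close> a
  translate \<open>k v\<^sub>0\<close>, so that the walk can be followed in \<open>\<Delta>\<close> through the points \<open>k w\<^sub>0\<close>. The
  additive constant is the cost of changing \<open>k\<close> within its coset of the stabilizer of \<open>v\<^sub>0\<close>.\<close>

lemma orbit_dist_coarse_lipschitz:
  fixes G (structure) and \<Gamma> :: "'v pair_pre_digraph" and \<Delta> :: "'w pair_pre_digraph"
  assumes TG: "topological_group G T"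
    and \<Gamma>: "pair_bidirected_digraph \<Gamma>" "Digraph_Component.connected (with_proj \<Gamma>)"
      "locally_finite \<Gamma>"
    and \<alpha>: "transitive_action G (pverts \<Gamma>) \<alpha>"
      "\<And>g. g \<in> carrier G \<Longrightarrow> graph_automorphism \<Gamma> (\<alpha> g)"
    and v0: "v0 \<in> pverts \<Gamma>" "compactin T (stabilizer G \<alpha> v0)"
    and \<Delta>: "pair_bidirected_digraph \<Delta>" "Digraph_Component.connected (with_proj \<Delta>)"
    and \<beta>: "group_action G (pverts \<Delta>) \<beta>"
      "\<And>g. g \<in> carrier G \<Longrightarrow> graph_automorphism \<Delta> (\<beta> g)"
    and w0: "w0 \<in> pverts \<Delta>" "openin T (stabilizer G \<beta> w0)"
  shows "\<exists>C. \<forall>g \<in> carrier G. \<forall>h \<in> carrier G.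
    graph_dist \<Delta> (\<beta> g w0) (\<beta> h w0) \<le> C * graph_dist \<Gamma> (\<alpha> g v0) (\<alpha> h v0) + C"
proof -
  interpret topological_group G T by fact
  interpret \<Gamma>: pair_bidirected_digraph \<Gamma> by fact
  interpret \<alpha>: transitive_action G "pverts \<Gamma>" \<alpha> by fact
  interpret \<beta>: group_action G "pverts \<Delta>" \<beta> by fact
  interpret d\<Delta>: Metric_space "pverts \<Delta>" "\<lambda>u v. real (graph_dist \<Delta> u v)"
    using Metric_space_graph_dist[OF \<Delta>] .
  define N where "N = insert v0 {u. (v0, u) \<in> parcs \<Gamma>}"
  define S where "S = (\<Union>u \<in> N. {g \<in> carrier G. \<alpha> g v0 = u})"
  have "finite N"
    using \<Gamma>(3) v0(1) by (simp add: N_def locally_finite_def)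
  then have "compactin T S"
    unfolding S_def using compactin_orbit_map_fibre[OF TG \<alpha>.group_action_axioms v0]
    by (intro compactin_Union) auto
  from image_compactin[OF this continuous_map_orbit_map[OF TG \<beta>(1) w0]]
  have "finite ((\<lambda>g. \<beta> g w0) ` S)"
    by (simp add: compactin_discrete_topology)
  then have "finite (graph_dist \<Delta> w0 ` (\<lambda>g. \<beta> g w0) ` S)"
    by (rule finite_imageI)
  then obtain C where C: "graph_dist \<Delta> w0 (\<beta> s w0) \<le> C" if "s \<in> S" for s
    unfolding finite_nat_set_iff_bounded_le by auto
  \<comment> \<open>Elements that are equal or adjacent as seen in \<open>\<Gamma>\<close> differ by an element of \<open>S\<close>.\<close>
  have step: "graph_dist \<Delta> (\<beta> g w0) (\<beta> h w0) \<le> C"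
    if g: "g \<in> carrier G" and h: "h \<in> carrier G"
      and gh: "\<alpha> g v0 = \<alpha> h v0 \<or> (\<alpha> g v0, \<alpha> h v0) \<in> parcs \<Gamma>" for g h
  proof -
    define s where "s = inv g \<otimes> h"
    have s: "s \<in> carrier G" and gs: "h = g \<otimes> s"
      using g h by (simp_all add: s_def flip: m_assoc)
    have sv: "\<alpha> s v0 \<in> pverts \<Gamma>"
      using \<alpha>.element_image[OF s v0(1) refl] .
    have h_eq: "\<alpha> h v0 = \<alpha> g (\<alpha> s v0)" "\<beta> h w0 = \<beta> g (\<beta> s w0)"
      unfolding gs using g s v0 w0 by (simp_all add: \<alpha>.composition_rule \<beta>.composition_rule)
    have "\<alpha> s v0 \<in> N"
      using gh \<alpha>(2)[OF g] \<alpha>.inj_prop[OF g] v0(1) sv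
      by (auto simp: h_eq(1) N_def graph_automorphism_def dest: inj_onD)
    then have "graph_dist \<Delta> w0 (\<beta> s w0) \<le> C"
      using s by (intro C) (auto simp: S_def)
    moreover have "graph_dist \<Delta> (\<beta> g w0) (\<beta> g (\<beta> s w0)) \<le> graph_dist \<Delta> w0 (\<beta> s w0)"
      using graph_dist_automorphism_le[OF \<Delta> \<beta>(2)[OF g] w0(1)]
        \<beta>.element_image[OF s w0(1) refl] by blast
    ultimately show ?thesis by (simp add: h_eq(2))
  qed
  have walk: "graph_dist \<Delta> (\<beta> g w0) (\<beta> h w0) \<le> C * n + C"
    if "g \<in> carrier G" "h \<in> carrier G" "(\<alpha> g v0, \<alpha> h v0) \<in> parcs \<Gamma> ^^ n" for g h n
    using that
  proof (induction n arbitrary: h)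
    case 0
    then show ?case using step by simp
  next
    case (Suc n)
    then obtain u where u: "(\<alpha> g v0, u) \<in> parcs \<Gamma> ^^ n" "(u, \<alpha> h v0) \<in> parcs \<Gamma>" by auto
    then have "u \<in> pverts \<Gamma>" using \<Gamma>.in_arcsD1 by blast
    then obtain k where k: "k \<in> carrier G" "u = \<alpha> k v0"
      using \<alpha>.unique_orbit[OF v0(1)] by blast
    have "real (graph_dist \<Delta> (\<beta> g w0) (\<beta> h w0))
        \<le> real (graph_dist \<Delta> (\<beta> g w0) (\<beta> k w0)) + real (graph_dist \<Delta> (\<beta> k w0) (\<beta> h w0))"
      using Suc.prems k \<beta>.element_image[OF _ w0(1) refl] by (intro d\<Delta>.triangle) auto
    moreover have "graph_dist \<Delta> (\<beta> g w0) (\<beta> k w0) \<le> C * n + C"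
      using Suc.IH Suc.prems k u by blast
    moreover have "graph_dist \<Delta> (\<beta> k w0) (\<beta> h w0) \<le> C"
      using step Suc.prems k u by blast
    ultimately show ?case by simp
  qed
  show ?thesis
    using walk graph_dist_walk[OF \<Gamma>(1,2)] \<alpha>.element_image[OF _ v0(1) refl] by blast
qed

section \<open>Quasi-isometry of locally finite rough Cayley graphs\<close>

theorem theorem4p6:
  fixes G :: "('a, 'b) monoid_scheme" and T :: "'a topology"
  assumes "topological_group G T"
    and "compactly_generated G T"
    and "\<exists>\<Gamma> :: 'u pair_pre_digraph. rough_cayley_graph G T \<Gamma> \<and> locally_finite \<Gamma>"
  shows "\<forall>(\<Gamma> :: 'v pair_pre_digraph) (\<Delta> :: 'w pair_pre_digraph).
    rough_cayley_graph G T \<Gamma> \<and> locally_finite \<Gamma> \<and>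
    rough_cayley_graph G T \<Delta> \<and> locally_finite \<Delta> \<longrightarrow>
    quasi_isometric_graphs \<Gamma> \<Delta>"
proof (intro allI impI, elim conjE)
  fix \<Gamma> :: "'v pair_pre_digraph" and \<Delta> :: "'w pair_pre_digraph"
  assume "rough_cayley_graph G T \<Gamma>" and lf\<Gamma>: "locally_finite \<Gamma>"
    and "rough_cayley_graph G T \<Delta>" and lf\<Delta>: "locally_finite \<Delta>"
  then obtain \<alpha> \<beta>
    where \<Gamma>: "pair_bidirected_digraph \<Gamma>" "Digraph_Component.connected (with_proj \<Gamma>)"
      and \<alpha>: "transitive_action G (pverts \<Gamma>) \<alpha>"
        "\<And>g. g \<in> carrier G \<Longrightarrow> graph_automorphism \<Gamma> (\<alpha> g)"
      and stab\<alpha>: "\<And>v. v \<in> pverts \<Gamma> \<Longrightarrow> compactin T (stabilizer G \<alpha> v)"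
        "\<And>v. v \<in> pverts \<Gamma> \<Longrightarrow> openin T (stabilizer G \<alpha> v)"
      and \<Delta>: "pair_bidirected_digraph \<Delta>" "Digraph_Component.connected (with_proj \<Delta>)"
      and \<beta>: "transitive_action G (pverts \<Delta>) \<beta>"
        "\<And>g. g \<in> carrier G \<Longrightarrow> graph_automorphism \<Delta> (\<beta> g)"
      and stab\<beta>: "\<And>w. w \<in> pverts \<Delta> \<Longrightarrow> compactin T (stabilizer G \<beta> w)"
        "\<And>w. w \<in> pverts \<Delta> \<Longrightarrow> openin T (stabilizer G \<beta> w)"
    unfolding rough_cayley_graph_def by blast
  interpret \<alpha>: transitive_action G "pverts \<Gamma>" \<alpha> by fact
  interpret \<beta>: transitive_action G "pverts \<Delta>" \<beta> by fact
  interpret d\<Gamma>: Metric_space "pverts \<Gamma>" "\<lambda>u v. real (graph_dist \<Gamma> u v)"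
    using Metric_space_graph_dist[OF \<Gamma>] .
  interpret d\<Delta>: Metric_space "pverts \<Delta>" "\<lambda>u v. real (graph_dist \<Delta> u v)"
    using Metric_space_graph_dist[OF \<Delta>] .
  obtain v0 w0 where v0: "v0 \<in> pverts \<Gamma>" and w0: "w0 \<in> pverts \<Delta>"
    using \<Gamma>(2) \<Delta>(2) by (auto simp: Digraph_Component.connected_def strongly_connected_def)
  obtain C where C: "\<And>g h. g \<in> carrier G \<Longrightarrow> h \<in> carrier G \<Longrightarrow>
      graph_dist \<Delta> (\<beta> g w0) (\<beta> h w0) \<le> C * graph_dist \<Gamma> (\<alpha> g v0) (\<alpha> h v0) + C"
    using orbit_dist_coarse_lipschitz[OF assms(1) \<Gamma> lf\<Gamma> \<alpha> v0 stab\<alpha>(1)[OF v0]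
        \<Delta> \<beta>.group_action_axioms \<beta>(2) w0 stab\<beta>(2)[OF w0]] by blast
  obtain D where D: "\<And>g h. g \<in> carrier G \<Longrightarrow> h \<in> carrier G \<Longrightarrow>
      graph_dist \<Gamma> (\<alpha> g v0) (\<alpha> h v0) \<le> D * graph_dist \<Delta> (\<beta> g w0) (\<beta> h w0) + D"
    using orbit_dist_coarse_lipschitz[OF assms(1) \<Delta> lf\<Delta> \<beta> w0 stab\<beta>(1)[OF w0]
        \<Gamma> \<alpha>.group_action_axioms \<alpha>(2) v0 stab\<alpha>(2)[OF v0]] by blast
  obtain t where t: "\<And>v. v \<in> pverts \<Gamma> \<Longrightarrow> t v \<in> carrier G"
      "\<And>v. v \<in> pverts \<Gamma> \<Longrightarrow> \<alpha> (t v) v0 = v"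
    using \<alpha>.unique_orbit[OF v0] by metis
  define f where "f = (\<lambda>v. \<beta> (t v) w0)"
  \<comment> \<open>With \<open>a = b = M\<close> the lower bound on \<open>d\<^sub>\<Delta>\<close> in a quasi-isometry reads
    \<open>d\<^sub>\<Gamma> \<le> M d\<^sub>\<Delta> + M\<close>, and the summand \<open>1\<close> ensures \<open>a \<ge> 1\<close>.\<close>
  define M where "M = C + D + 1"
  have "C \<le> M" "D \<le> M" "M \<ge> 1" by (simp_all add: M_def)
  have f_in: "f v \<in> pverts \<Delta>" if "v \<in> pverts \<Gamma>" for v
    unfolding f_def using \<beta>.element_image t(1)[OF that] w0 by blast
  have upper: "graph_dist \<Delta> (f u) (f v) \<le> M * graph_dist \<Gamma> u v + M"
    and lower: "graph_dist \<Gamma> u v \<le> M * graph_dist \<Delta> (f u) (f v) + M"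
    if u: "u \<in> pverts \<Gamma>" and v: "v \<in> pverts \<Gamma>" for u v
  proof -
    have "graph_dist \<Delta> (f u) (f v) \<le> C * graph_dist \<Gamma> u v + C"
      using C[OF t(1)[OF u] t(1)[OF v]] by (simp add: t(2) u v f_def)
    also have "\<dots> \<le> M * graph_dist \<Gamma> u v + M"
      using \<open>C \<le> M\<close> by (intro add_mono mult_right_mono) auto
    finally show "graph_dist \<Delta> (f u) (f v) \<le> M * graph_dist \<Gamma> u v + M" .
    have "graph_dist \<Gamma> u v \<le> D * graph_dist \<Delta> (f u) (f v) + D"
      using D[OF t(1)[OF u] t(1)[OF v]] by (simp add: t(2) u v f_def)
    also have "\<dots> \<le> M * graph_dist \<Delta> (f u) (f v) + M"
      using \<open>D \<le> M\<close> by (intro add_mono mult_right_mono) auto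
    finally show "graph_dist \<Gamma> u v \<le> M * graph_dist \<Delta> (f u) (f v) + M" .
  qed
  \<comment> \<open>The vertex \<open>g w\<^sub>0\<close> is near the image of \<open>g v\<^sub>0\<close>: the chosen representative of \<open>g v\<^sub>0\<close>
    agrees with \<open>g\<close> on \<open>v\<^sub>0\<close>, so only the additive constant remains.\<close>
  have dense: "\<exists>v \<in> pverts \<Gamma>. graph_dist \<Delta> w (f v) \<le> M" if w: "w \<in> pverts \<Delta>" for w
  proof -
    obtain g where g: "g \<in> carrier G" "\<beta> g w0 = w" using \<beta>.unique_orbit[OF w0 w] by blast
    define v where "v = \<alpha> g v0"
    have v: "v \<in> pverts \<Gamma>" unfolding v_def using \<alpha>.element_image[OF g(1) v0 refl] .
    have "graph_dist \<Gamma> v v = 0"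
      using d\<Gamma>.zero[OF v v] by simp
    then have "graph_dist \<Delta> w (f v) \<le> C"
      using C[OF g(1) t(1)[OF v]] by (simp add: g t(2)[OF v] f_def flip: v_def)
    then show ?thesis using v \<open>C \<le> M\<close> by (meson le_trans)
  qed
  show "quasi_isometric_graphs \<Gamma> \<Delta>"
    unfolding quasi_isometric_graphs_def quasi_isometric_def graph_metric_def
      d\<Gamma>.mspace_metric d\<Gamma>.mdist_metric d\<Delta>.mspace_metric d\<Delta>.mdist_metric
  proof (intro exI[of _ f] exI[of _ "real M"] conjI ballI)
    show "f ` pverts \<Gamma> \<subseteq> pverts \<Delta>" using f_in by blast
    show "1 \<le> real M" "0 \<le> real M" using \<open>M \<ge> 1\<close> by simp_all
  next
    fix u v assume uv: "u \<in> pverts \<Gamma>" "v \<in> pverts \<Gamma>"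
    have "real (graph_dist \<Delta> (f u) (f v)) \<le> real M * real (graph_dist \<Gamma> u v) + real M"
      using upper[OF uv] by (simp flip: of_nat_mult of_nat_add)
    moreover have "real M \<le> real M * real M" using \<open>M \<ge> 1\<close> by simp
    ultimately show "real (graph_dist \<Delta> (f u) (f v))
        \<le> real M * real (graph_dist \<Gamma> u v) + real M * real M"
      by linarith
    have "real (graph_dist \<Gamma> u v) \<le> real M * real (graph_dist \<Delta> (f u) (f v)) + real M"
      using lower[OF uv] by (simp flip: of_nat_mult of_nat_add)
    then show "inverse (real M) * real (graph_dist \<Gamma> u v) - inverse (real M) * real M
        \<le> real (graph_dist \<Delta> (f u) (f v))"
      using \<open>M \<ge> 1\<close> by (simp add: field_simps)
  next
    fix w assume "w \<in> pverts \<Delta>"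
    from dense[OF this] show "(INF z \<in> f ` pverts \<Gamma>. ereal (real (graph_dist \<Delta> w z)))
        \<le> ereal (real M)"
      by (auto intro: INF_lower2)
  qed
qed

end
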